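(* Let $\mathbf{p}=(p_1,\dots,p_J)$ be a probability vector (winning probabilities with $\sum_{j=1}^J p_j=1$), and let $\mathbf{k}=(k_1,\dots,k_J)$ with $k_j>1$ and $\sum_{j=1}^J1/k_j^2\le1$. For $\boldsymbol{\eta}=(\eta_1,\dots,\eta_J)$ with $\eta_j\in(0,1)$ and $\sum_{j=1}^J\eta_j^2=1$, put $$G(\boldsymbol{\eta},\mathbf{k},\mathbf{p}):=\sum_{j=1}^J p_j\log_2(k_j\eta_j).$$ Let $j_1,j_2,\dots$ be i.i.d. random variables with values in $\{1,\dots,J\}$ and $\Pr[j_\ell=j]=p_j$, let $g_j:=k_j\eta_j$ and $\bar g_t:=g_{j_t}\cdots g_{j_1}$. Then $$\Pr\Big[\lim_{t\to\infty}\frac{\log_2\bar g_t}{t}=G(\boldsymbol{\eta},\mathbf{k},\mathbf{p})\Big]=1,$$ and the maximum doubling rate $G^*(\mathbf{k},\mathbf{p}):=\max_{\boldsymbol{\eta}}G(\boldsymbol{\eta},\mathbf{k},\mathbf{p})$ (with $\mathbf{k}$, $\mathbf{p}$ fixed) is obtained by setting $\eta_j^2=p_j$ for all $j$.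
   Context: Here $J$ is the number of horses in a race, $\eta_j$ is the effective transmissivity with which a gambler sends a Bosonic mode to horse $j$ (so $\eta_j^2$ plays the role of the fraction of capital bet on horse $j$), $k_j$ is the amplification gain returned if horse $j$ wins (so $k_j^2$ plays the role of the odds, and $\sum_j 1/k_j^2\le 1$ expresses fair or super-fair odds), and $p_j$ is the winning probability of horse $j$; $G$ is the asymptotic doubling rate of the amplification factor $\bar g_t$.
   Formalization: The maximum G* is taken as a supremum over η; that it is attained at η_j²=p_j is asserted only when all p_j>0, because if some p_j=0 this choice leaves (0,1) and no maximum exists (e.g. p=(1,0)); there G at η_j²=p_j, with 0·log 0=0, is shown to equal the supremum. *)

theory Defs
  imports "HOL-Probability.Probability"
begin

text \<open>
  Vectors indexed by \<open>1, \<dots>, J\<close> are functions on \<^typ>\<open>nat\<close> of which only the values on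
  \<open>{1..J}\<close> matter.
\<close>

definition prob_vector :: "nat \<Rightarrow> (nat \<Rightarrow> real) \<Rightarrow> bool" where
  "prob_vector J p \<longleftrightarrow> (\<forall>j\<in>{1..J}. 0 \<le> p j) \<and> (\<Sum>j=1..J. p j) = 1"

definition gain_vector :: "nat \<Rightarrow> (nat \<Rightarrow> real) \<Rightarrow> bool" where
  "gain_vector J k \<longleftrightarrow> (\<forall>j\<in>{1..J}. 1 < k j) \<and> (\<Sum>j=1..J. 1 / (k j)\<^sup>2) \<le> 1"

definition betting_vector :: "nat \<Rightarrow> (nat \<Rightarrow> real) \<Rightarrow> bool" where
  "betting_vector J \<eta> \<longleftrightarrow>
     (\<forall>j\<in>{1..J}. 0 < \<eta> j \<and> \<eta> j < 1) \<and> (\<Sum>j=1..J. (\<eta> j)\<^sup>2) = 1"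

text \<open>
  In the library \<open>log 2 0 = 0\<close>. The convention is only relevant when \<open>\<eta> j = 0\<close>, which does not
  occur for betting vectors; for \<open>\<eta> j = sqrt (p j)\<close> with \<open>p j = 0\<close> the term is
  \<open>0 * log 2 0 = 0\<close>, as usual in information theory.
\<close>

definition doubling_rate ::
    "nat \<Rightarrow> (nat \<Rightarrow> real) \<Rightarrow> (nat \<Rightarrow> real) \<Rightarrow> (nat \<Rightarrow> real) \<Rightarrow> real" where
  "doubling_rate J \<eta> k p = (\<Sum>j=1..J. p j * log 2 (k j * \<eta> j))"

text \<open>
  The maximum over betting vectors is written as a supremum, since the set of betting vectors is
  not compact: if some \<open>p j\<close> vanishes, the maximum is only approached.
\<close>

definition max_doubling_rate :: "nat \<Rightarrow> (nat \<Rightarrow> real) \<Rightarrow> (nat \<Rightarrow> real) \<Rightarrow> real" where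
  "max_doubling_rate J k p = (SUP \<eta>\<in>{\<eta>. betting_vector J \<eta>}. doubling_rate J \<eta> k p)"

definition amplification ::
    "(nat \<Rightarrow> real) \<Rightarrow> (nat \<Rightarrow> real) \<Rightarrow> (nat \<Rightarrow> 'w \<Rightarrow> nat) \<Rightarrow> nat \<Rightarrow> 'w \<Rightarrow> real" where
  "amplification k \<eta> X t \<omega> = (\<Prod>l=1..t. k (X l \<omega>) * \<eta> (X l \<omega>))"

end

theory Submission
  imports Defs
begin

text \<open>
  The logarithm of the amplification is a sum of bounded i.i.d. variables with mean \<open>G\<close>, so
  Hoeffding's inequality makes its deviation probabilities summable, and Borel--Cantelli gives almost
  sure convergence of the averages. Optimality of \<open>\<eta>\<^sub>j\<^sup>2 = p\<^sub>j\<close> is Gibbs' inequality, i.e.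
  \<open>ln x \<le> x - 1\<close> at \<open>x = \<eta>\<^sub>j\<^sup>2 / p\<^sub>j\<close>.
\<close>

section \<open>Strong law of large numbers for bounded variables\<close>

lemma (in prob_space) strong_law_bounded:
  fixes Y :: "nat \<Rightarrow> 'a \<Rightarrow> real"
  assumes indep: "indep_vars (\<lambda>_. borel) Y {1..}"
    and bounded: "\<And>l. 1 \<le> l \<Longrightarrow> AE x in M. \<bar>Y l x\<bar> \<le> B"
    and mean: "\<And>l. 1 \<le> l \<Longrightarrow> expectation (Y l) = \<mu>"
  shows "AE x in M. (\<lambda>t. (\<Sum>l=1..t. Y l x) / real t) \<longlonglongrightarrow> \<mu>"
proof -
  \<comment> \<open>Enlarging the bound keeps the intervals \<open>{-C..C}\<close> of positive width
    even when \<open>B = 0\<close>, so Hoeffding's denominator is nonzero.\<close>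
  define C where "C = \<bar>B\<bar> + 1"
  have C: "C > 0" and B_le: "B \<le> C" by (auto simp: C_def)
  have Y_meas: "Y l \<in> borel_measurable M" if "1 \<le> l" for l
    using indep that by (auto simp: indep_vars_def)
  define S where "S t x = (\<Sum>l=1..t. Y l x)" for t x
  have S_meas [measurable]: "S t \<in> borel_measurable M" for t
    unfolding S_def by (intro borel_measurable_sum Y_meas) auto
  have tail: "prob {x \<in> space M. \<bar>S t x - real t * \<mu>\<bar> \<ge> real t * \<epsilon>}
      \<le> 2 * exp (- (\<epsilon>\<^sup>2 / (2 * C\<^sup>2))) ^ t" if "\<epsilon> > 0" "t > 0" for \<epsilon> :: real and t
  proof -
    interpret Hoeffding_ineq M "{1..t}" Y "\<lambda>_. - C" "\<lambda>_. C" "\<Sum>l=1..t. expectation (Y l)"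
    proof unfold_locales
      show "indep_vars (\<lambda>_. borel) Y {1..t}"
        by (rule indep_vars_subset[OF indep]) auto
      show "AE x in M. Y l x \<in> {-C..C}" if "l \<in> {1..t}" for l
        using bounded[of l] that B_le by (auto simp: abs_le_iff)
    qed auto
    have "(\<Sum>l=1..t. expectation (Y l)) = real t * \<mu>"
      by (simp add: mean)
    moreover have "(\<Sum>l=1..t. (C - - C)\<^sup>2) = real t * (4 * C\<^sup>2)"
      by (simp add: power2_eq_square)
    ultimately have "prob {x \<in> space M. \<bar>S t x - real t * \<mu>\<bar> \<ge> real t * \<epsilon>}
        \<le> 2 * exp (- 2 * (real t * \<epsilon>)\<^sup>2 / (real t * (4 * C\<^sup>2)))"
      using Hoeffding_ineq_abs_ge[of "real t * \<epsilon>"] that C by (simp add: S_def)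
    \<comment> \<open>The squared deviation grows like \<open>t\<close> squared and the sum of
      squared widths like \<open>t\<close>. The exponent is therefore linear in \<open>t\<close>,
      and the bound is a geometric sequence.\<close>
    also have "- 2 * (real t * \<epsilon>)\<^sup>2 / (real t * (4 * C\<^sup>2)) = real t * (- (\<epsilon>\<^sup>2 / (2 * C\<^sup>2)))"
      using that C by (simp add: field_simps power2_eq_square)
    finally show ?thesis by (simp only: exp_of_nat_mult)
  qed
  \<comment> \<open>Borel-Cantelli gives one null set per tolerance; restricting to the countably
    many tolerances \<open>1 / real (Suc n)\<close> lets a single null set serve for all of
    them.\<close>
  have "AE x in M. \<forall>n. eventually (\<lambda>t. \<bar>S t x - real t * \<mu>\<bar> < real t * (1 / real (Suc n))) sequentially"
    unfolding AE_all_countable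
  proof
    fix n
    define \<epsilon> :: real where "\<epsilon> = 1 / real (Suc n)"
    have \<epsilon>: "\<epsilon> > 0" by (simp add: \<epsilon>_def)
    define A where "A t = {x \<in> space M. \<bar>S t x - real t * \<mu>\<bar> \<ge> real t * \<epsilon>}" for t
    have [measurable]: "A t \<in> sets M" for t unfolding A_def by measurable
    have "summable (\<lambda>t. 2 * exp (- (\<epsilon>\<^sup>2 / (2 * C\<^sup>2))) ^ t)"
      using \<epsilon> C by (intro summable_mult summable_geometric) simp
    then have "summable (\<lambda>t. prob (A t))"
      \<comment> \<open>The comparison starts at 1 because \<open>tail\<close> is established for
        \<open>t > 0\<close>.\<close>
      by (rule summable_comparison_test'[where N = 1]) (use tail[OF \<epsilon>] in \<open>auto simp: A_def\<close>)
    then have "AE x in M. eventually (\<lambda>t. x \<in> space M - A t) sequentially"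
      by (intro borel_cantelli_AE1) (auto simp: emeasure_eq_measure)
    then show "AE x in M. eventually (\<lambda>t. \<bar>S t x - real t * \<mu>\<bar> < real t * (1 / real (Suc n))) sequentially"
      by (rule AE_mp) (auto intro!: AE_I2 elim!: eventually_mono simp: A_def \<epsilon>_def)
  qed
  then show ?thesis
  proof (rule AE_mp, intro AE_I2 impI)
    fix x
    assume ev: "\<forall>n. eventually (\<lambda>t. \<bar>S t x - real t * \<mu>\<bar> < real t * (1 / real (Suc n))) sequentially"
    have "(\<lambda>t. S t x / real t) \<longlonglongrightarrow> \<mu>"
    proof (rule tendstoI)
      fix e :: real assume "e > 0"
      then obtain n where n: "1 / real (Suc n) < e"
        using reals_Archimedean by (auto simp: inverse_eq_divide)
      show "eventually (\<lambda>t. dist (S t x / real t) \<mu> < e) sequentially"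
        using ev[rule_format, of n] eventually_gt_at_top[of 0]
      proof eventually_elim
        case (elim t)
        have "dist (S t x / real t) \<mu> = \<bar>S t x - real t * \<mu>\<bar> / real t"
        proof -
          have "S t x / real t - \<mu> = (S t x - real t * \<mu>) / real t"
            using elim by (simp add: field_simps)
          then show ?thesis using elim by (simp add: dist_real_def)
        qed
        also have "\<dots> < 1 / real (Suc n)"
          using elim by (simp add: field_simps)
        finally show ?case using n by simp
      qed
    qed
    then show "(\<lambda>t. (\<Sum>l=1..t. Y l x) / real t) \<longlonglongrightarrow> \<mu>"
      by (simp add: S_def)
  qed
qed

section \<open>Finite-valued outcomes and growth of the amplification\<close>

lemma (in prob_space) expectation_finite_range:
  fixes f :: "'b \<Rightarrow> real"
  assumes X: "X \<in> measurable M (count_space A)" and A: "finite A"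
  shows "expectation (\<lambda>x. f (X x)) = (\<Sum>a\<in>A. prob {x \<in> space M. X x = a} * f a)"
proof -
  have sets: "{x \<in> space M. X x = a} \<in> sets M" if "a \<in> A" for a
  proof -
    have "X -` {a} \<inter> space M \<in> sets M"
      using X that by (intro measurable_sets[OF X]) auto
    also have "X -` {a} \<inter> space M = {x \<in> space M. X x = a}" by auto
    finally show ?thesis .
  qed
  have "expectation (\<lambda>x. f (X x)) =
      expectation (\<lambda>x. \<Sum>a\<in>A. f a * indicator {x \<in> space M. X x = a} x)"
  proof (rule Bochner_Integration.integral_cong[OF refl])
    fix x assume x: "x \<in> space M"
    then have "X x \<in> A" using measurable_space[OF X] by simp
    then show "f (X x) = (\<Sum>a\<in>A. f a * indicator {x \<in> space M. X x = a} x)"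
      using A x by (simp add: indicator_def if_distrib[of "times _"] cong: if_cong)
  qed
  also have "\<dots> = (\<Sum>a\<in>A. expectation (\<lambda>x. f a * indicator {x \<in> space M. X x = a} x))"
    using sets by (intro Bochner_Integration.integral_sum) (auto intro!: integrable_real_indicator simp: emeasure_eq_measure)
  also have "\<dots> = (\<Sum>a\<in>A. prob {x \<in> space M. X x = a} * f a)"
    using sets by (intro sum.cong) (auto simp: mult.commute)
  finally show ?thesis .
qed

text \<open>With no horse the sum of squares is 0, and with one horse it forces
  \<open>\<eta> 1 = 1\<close>, which the strict bound excludes. A single betting vector thus
  supplies the second index that the optimality argument uses.\<close>

lemma betting_vector_at_least_2:
  assumes "betting_vector J \<eta>"
  shows "2 \<le> J"
proof (rule ccontr)
  assume "\<not> 2 \<le> J"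
  then have "J = 0 \<or> J = 1" by auto
  then show False
    using assms by (auto simp: betting_vector_def power2_eq_1_iff)
qed

text \<open>The logarithm turns the product of gains into a sum of the variables
  \<open>f (X l \<omega>)\<close>, whose mean is \<open>doubling_rate J \<eta> k p\<close> by the
  finite expectation formula; the strong law then applies.\<close>

lemma amplification_asymptotics:
  assumes k: "gain_vector J k" and \<eta>: "betting_vector J \<eta>"
    and M: "prob_space M"
    and indep: "prob_space.indep_vars M (\<lambda>_. count_space {1..J}) X {1..}"
    and distr: "\<And>l j. 1 \<le> l \<Longrightarrow> j \<in> {1..J} \<Longrightarrow> measure M {\<omega> \<in> space M. X l \<omega> = j} = p j"
  shows "measure M {\<omega> \<in> space M.
           (\<lambda>t. log 2 (amplification k \<eta> X t \<omega>) / real t) \<longlonglongrightarrow> doubling_rate J \<eta> k p} = 1"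
proof -
  interpret prob_space M by (rule M)
  define f where "f j = log 2 (k j * \<eta> j)" for j
  have X: "X l \<in> measurable M (count_space {1..J})" if "1 \<le> l" for l
    using indep that by (auto simp: indep_vars_def)
  have X_in: "X l \<omega> \<in> {1..J}" if "1 \<le> l" "\<omega> \<in> space M" for l \<omega>
    using measurable_space[OF X] that by simp
  have pos: "k j * \<eta> j > 0" if "j \<in> {1..J}" for j
  proof -
    have "1 < k j" "0 < \<eta> j" using that k \<eta> by (auto simp: gain_vector_def betting_vector_def)
    then show ?thesis by simp
  qed
  have meas: "(\<lambda>\<omega>. \<Sum>l=1..t. f (X l \<omega>)) \<in> borel_measurable M" for t
    by (intro borel_measurable_sum measurable_compose[OF X]) auto
  \<comment> \<open>Splitting the logarithm requires nonzero factors, which is guaranteed on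
    \<open>space M\<close>, where the outcomes lie in \<open>{1..J}\<close>.\<close>
  have log_eq: "log 2 (amplification k \<eta> X t \<omega>) = (\<Sum>l=1..t. f (X l \<omega>))"
    if "\<omega> \<in> space M" for t \<omega>
  proof -
    have "k (X l \<omega>) * \<eta> (X l \<omega>) \<noteq> 0" if "l \<in> {1..t}" for l
      using pos[OF X_in[of l \<omega>]] that \<open>\<omega> \<in> space M\<close> by auto
    then have "ln (\<Prod>l=1..t. k (X l \<omega>) * \<eta> (X l \<omega>)) = (\<Sum>l=1..t. ln (k (X l \<omega>) * \<eta> (X l \<omega>)))"
      by (intro ln_prod finite_atLeastAtMost)
    then show ?thesis
      by (simp add: amplification_def f_def log_def sum_divide_distrib)
  qed
  have "AE \<omega> in M. (\<lambda>t. (\<Sum>l=1..t. f (X l \<omega>)) / real t) \<longlonglongrightarrow> doubling_rate J \<eta> k p"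
  proof (rule strong_law_bounded[where B = "\<Sum>j=1..J. \<bar>f j\<bar>"])
    show "indep_vars (\<lambda>_. borel) (\<lambda>l \<omega>. f (X l \<omega>)) {1..}"
      by (rule indep_vars_compose2[OF indep]) auto
    \<comment> \<open>Only finitely many values of \<open>f\<close> occur, so the sum of their
      absolute values is a bound common to all \<open>l\<close>.\<close>
    show "AE \<omega> in M. \<bar>f (X l \<omega>)\<bar> \<le> (\<Sum>j=1..J. \<bar>f j\<bar>)" if "1 \<le> l" for l
      by (rule AE_I2, rule member_le_sum[OF X_in[OF that]]) auto
    show "expectation (\<lambda>\<omega>. f (X l \<omega>)) = doubling_rate J \<eta> k p" if "1 \<le> l" for l
      using expectation_finite_range[OF X[OF that], of f] distr[OF that]
      by (simp add: doubling_rate_def f_def)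
  qed
  \<comment> \<open>Measurability of the convergence set is what turns the almost sure statement
    into measure 1.\<close>
  moreover have "{\<omega> \<in> space M. (\<lambda>t. (\<Sum>l=1..t. f (X l \<omega>)) / real t) \<longlonglongrightarrow> doubling_rate J \<eta> k p} \<in> sets M"
    using meas by measurable
  ultimately have "prob {\<omega> \<in> space M.
      (\<lambda>t. (\<Sum>l=1..t. f (X l \<omega>)) / real t) \<longlonglongrightarrow> doubling_rate J \<eta> k p} = 1"
    by (subst prob_eq_1) auto
  then show ?thesis
    using log_eq by (simp cong: conj_cong)
qed

section \<open>Gibbs' inequality and the maximal doubling rate\<close>

lemma doubling_rate_le:
  assumes p: "prob_vector J p" and k: "gain_vector J k" and \<eta>: "betting_vector J \<eta>"
  shows "doubling_rate J \<eta> k p \<le> doubling_rate J (\<lambda>j. sqrt (p j)) k p"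
proof -
  \<comment> \<open>The last summand is a slack that cancels on summation, since the squares of
    \<open>\<eta>\<close> and the entries of \<open>p\<close> both sum to 1. If
    \<open>p j = 0\<close>, both logarithmic terms vanish and the slack is nonnegative.\<close>
  have "p j * log 2 (k j * \<eta> j)
      \<le> p j * log 2 (k j * sqrt (p j)) + ((\<eta> j)\<^sup>2 - p j) / (2 * ln 2)" if "j \<in> {1..J}" for j
  proof (cases "p j = 0")
    case False
    have pj: "p j > 0" and kj: "k j > 0" and ej: "\<eta> j > 0"
      using p k \<eta> that False by (force simp: prob_vector_def gain_vector_def betting_vector_def)+
    have "ln ((\<eta> j)\<^sup>2 / p j) \<le> (\<eta> j)\<^sup>2 / p j - 1"
      using pj ej by (intro ln_le_minus_one) simp
    then have "p j * (2 * ln (\<eta> j) - ln (p j)) \<le> p j * ((\<eta> j)\<^sup>2 / p j - 1)"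
      using pj ej by (intro mult_left_mono) (simp_all add: ln_div ln_realpow)
    also have "\<dots> = (\<eta> j)\<^sup>2 - p j"
      using pj by (simp add: field_simps)
    finally have le: "p j * (2 * ln (\<eta> j) - ln (p j)) \<le> (\<eta> j)\<^sup>2 - p j" .
    \<comment> \<open>The gain \<open>k j\<close> cancels here, which is why the optimal bet does
      not depend on the odds. In the denominator, 2 comes from the square root and
      \<open>ln 2\<close> from the base of the logarithm.\<close>
    have "p j * log 2 (k j * \<eta> j) - p j * log 2 (k j * sqrt (p j))
        = p j * (2 * ln (\<eta> j) - ln (p j)) / (2 * ln 2)"
      using pj kj ej by (simp add: log_def ln_mult ln_sqrt field_simps)
    also have "\<dots> \<le> ((\<eta> j)\<^sup>2 - p j) / (2 * ln 2)"
      using le by (intro divide_right_mono) auto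
    finally show ?thesis by simp
  qed simp
  then have "doubling_rate J \<eta> k p
      \<le> (\<Sum>j=1..J. p j * log 2 (k j * sqrt (p j)) + ((\<eta> j)\<^sup>2 - p j) / (2 * ln 2))"
    unfolding doubling_rate_def by (rule sum_mono)
  also have "\<dots> = doubling_rate J (\<lambda>j. sqrt (p j)) k p
      + ((\<Sum>j=1..J. (\<eta> j)\<^sup>2) - (\<Sum>j=1..J. p j)) / (2 * ln 2)"
    by (simp add: doubling_rate_def sum.distrib sum_subtractf sum_divide_distrib[symmetric])
  also have "\<dots> = doubling_rate J (\<lambda>j. sqrt (p j)) k p"
    using p \<eta> by (simp add: prob_vector_def betting_vector_def)
  finally show ?thesis .
qed

lemma betting_vector_sqrt:
  assumes p: "prob_vector J p" and pos: "\<And>j. j \<in> {1..J} \<Longrightarrow> 0 < p j" and J: "2 \<le> J"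
  shows "betting_vector J (\<lambda>j. sqrt (p j))"
proof -
  have "p j < 1" if j: "j \<in> {1..J}" for j
  proof -
    \<comment> \<open>Any other index would do: its positive mass keeps \<open>p j\<close> strictly
      below 1.\<close>
    define i where "i = (if j = 1 then 2 else 1 :: nat)"
    have i: "i \<in> {1..J}" "i \<noteq> j" using J by (auto simp: i_def)
    have "p j < p j + p i" using pos i by simp
    also have "\<dots> = sum p {i, j}" using i by simp
    also have "\<dots> \<le> sum p {1..J}" using i j pos by (intro sum_mono2) (auto intro: less_imp_le)
    finally show ?thesis using p by (simp add: prob_vector_def)
  qed
  moreover have "(\<Sum>j=1..J. (sqrt (p j))\<^sup>2) = (\<Sum>j=1..J. p j)"
    using pos by (intro sum.cong) (auto simp: less_imp_le)
  ultimately show ?thesis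
    using p pos by (simp add: betting_vector_def prob_vector_def)
qed

text \<open>
  Mixing \<open>p\<close> with the uniform distribution makes all coordinates positive and costs at most
  \<open>- log 2 (1 - \<epsilon>) / 2\<close>; so the supremum over the non-compact set of betting vectors is
  attained in the limit even if some \<open>p j\<close> vanishes.
\<close>

lemma doubling_rate_approx:
  assumes p: "prob_vector J p" and k: "gain_vector J k" and J: "2 \<le> J"
    and \<epsilon>: "0 < \<epsilon>" "\<epsilon> < 1"
  obtains \<eta> where "betting_vector J \<eta>"
    "doubling_rate J (\<lambda>j. sqrt (p j)) k p + log 2 (1 - \<epsilon>) / 2 \<le> doubling_rate J \<eta> k p"
proof
  define q where "q j = (1 - \<epsilon>) * p j + \<epsilon> / real J" for j
  have p0: "p j \<ge> 0" if "j \<in> {1..J}" for j using p that by (auto simp: prob_vector_def)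
  have q_pos: "q j > 0" if "j \<in> {1..J}" for j
    using p0[OF that] \<epsilon> J by (auto simp: q_def intro!: add_nonneg_pos)
  have "sum q {1..J} = 1"
    using p J by (simp add: q_def sum.distrib sum_distrib_left[symmetric] prob_vector_def)
  then have "prob_vector J q"
    using q_pos by (auto simp: prob_vector_def less_imp_le)
  then show "betting_vector J (\<lambda>j. sqrt (q j))"
    using q_pos J by (rule betting_vector_sqrt)
  have "p j * log 2 (k j * sqrt (p j)) + p j * (log 2 (1 - \<epsilon>) / 2) \<le> p j * log 2 (k j * sqrt (q j))"
    if j: "j \<in> {1..J}" for j
  proof (cases "p j = 0")
    case False
    then have pj: "p j > 0" using p0[OF j] by simp
    have kj: "k j > 0" using k j by (force simp: gain_vector_def)
    \<comment> \<open>Discarding the uniform part of \<open>q j\<close> leaves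
      \<open>(1 - \<epsilon>) * p j\<close>. Its square root shifts the logarithm by a constant
      independent of \<open>j\<close>, and the weights \<open>p j\<close> sum to 1.\<close>
    have "log 2 (k j * sqrt (p j)) + log 2 (1 - \<epsilon>) / 2 = log 2 (k j * sqrt ((1 - \<epsilon>) * p j))"
      using pj kj \<epsilon> by (simp add: log_def ln_mult ln_sqrt real_sqrt_mult add_divide_distrib)
    also have "\<dots> \<le> log 2 (k j * sqrt (q j))"
      using pj kj \<epsilon> q_pos[OF j] by (simp add: q_def)
    finally show ?thesis
      unfolding distrib_left[symmetric] using pj by (intro mult_left_mono) simp_all
  qed simp
  then have "(\<Sum>j=1..J. p j * log 2 (k j * sqrt (p j)) + p j * (log 2 (1 - \<epsilon>) / 2))
      \<le> doubling_rate J (\<lambda>j. sqrt (q j)) k p"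
    unfolding doubling_rate_def by (rule sum_mono)
  then show "doubling_rate J (\<lambda>j. sqrt (p j)) k p + log 2 (1 - \<epsilon>) / 2
      \<le> doubling_rate J (\<lambda>j. sqrt (q j)) k p"
    using p by (simp add: doubling_rate_def sum.distrib prob_vector_def
        flip: sum_distrib_right sum_divide_distrib)
qed

text \<open>Gibbs' inequality makes the value at \<open>sqrt (p j)\<close> an upper bound. It is the
  least one: every upper bound dominates the approximations, whose loss
  \<open>log 2 (1 - \<epsilon>) / 2\<close> tends to 0 as \<open>\<epsilon>\<close> decreases to
  0.\<close>

lemma max_doubling_rate_eq:
  assumes p: "prob_vector J p" and k: "gain_vector J k" and J: "2 \<le> J"
  shows "max_doubling_rate J k p = doubling_rate J (\<lambda>j. sqrt (p j)) k p"
    (is "_ = ?D")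
  unfolding max_doubling_rate_def
proof (rule cSup_eq)
  fix r assume "r \<in> (\<lambda>\<eta>. doubling_rate J \<eta> k p) ` {\<eta>. betting_vector J \<eta>}"
  then show "r \<le> ?D" using doubling_rate_le[OF p k] by auto
next
  fix u assume u: "\<And>r. r \<in> (\<lambda>\<eta>. doubling_rate J \<eta> k p) ` {\<eta>. betting_vector J \<eta>} \<Longrightarrow> r \<le> u"
  have "((\<lambda>\<epsilon>. ?D + log 2 (1 - \<epsilon>) / 2) \<longlongrightarrow> ?D + log 2 (1 - 0) / 2) (at_right 0)"
    by (intro tendsto_intros) auto
  moreover have "eventually (\<lambda>\<epsilon>. ?D + log 2 (1 - \<epsilon>) / 2 \<le> u) (at_right 0)"
  proof (rule eventually_at_rightI[of 0 1])
    fix \<epsilon> :: real assume "\<epsilon> \<in> {0<..<1}"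
    then obtain \<eta> where "betting_vector J \<eta>"
      "?D + log 2 (1 - \<epsilon>) / 2 \<le> doubling_rate J \<eta> k p"
      using doubling_rate_approx[OF p k J, of \<epsilon>] by auto
    then show "?D + log 2 (1 - \<epsilon>) / 2 \<le> u" using u by force
  qed simp
  ultimately have "?D + log 2 (1 - 0) / 2 \<le> u"
    by (rule tendsto_upperbound) simp
  then show "?D \<le> u" by simp
qed

theorem mainTheorem2:
  fixes J :: nat
    and p k \<eta> :: "nat \<Rightarrow> real"
    and M :: "'w measure"
    and X :: "nat \<Rightarrow> 'w \<Rightarrow> nat"
  assumes p: "prob_vector J p"
    and k: "gain_vector J k"
    and \<eta>: "betting_vector J \<eta>"
    and M: "prob_space M"
    and indep: "prob_space.indep_vars M (\<lambda>_. count_space {1..J}) X {1..}"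
    and distr: "\<And>l j. 1 \<le> l \<Longrightarrow> j \<in> {1..J} \<Longrightarrow> measure M {\<omega> \<in> space M. X l \<omega> = j} = p j"
  shows "measure M {\<omega> \<in> space M.
             (\<lambda>t. log 2 (amplification k \<eta> X t \<omega>) / real t) \<longlonglongrightarrow> doubling_rate J \<eta> k p} = 1
         \<and> (\<forall>\<eta>'. betting_vector J \<eta>' \<longrightarrow>
                doubling_rate J \<eta>' k p \<le> doubling_rate J (\<lambda>j. sqrt (p j)) k p)
         \<and> max_doubling_rate J k p = doubling_rate J (\<lambda>j. sqrt (p j)) k p
         \<and> ((\<forall>j\<in>{1..J}. 0 < p j) \<longrightarrow>
                is_arg_max (\<lambda>\<eta>'. doubling_rate J \<eta>' k p) (betting_vector J) (\<lambda>j. sqrt (p j)))"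
proof (intro conjI allI impI)
  have J: "2 \<le> J" using \<eta> by (rule betting_vector_at_least_2)
  show "measure M {\<omega> \<in> space M.
      (\<lambda>t. log 2 (amplification k \<eta> X t \<omega>) / real t) \<longlonglongrightarrow> doubling_rate J \<eta> k p} = 1"
    by (rule amplification_asymptotics[OF k \<eta> M indep distr])
  show "doubling_rate J \<eta>' k p \<le> doubling_rate J (\<lambda>j. sqrt (p j)) k p"
    if "betting_vector J \<eta>'" for \<eta>'
    using p k that by (rule doubling_rate_le)
  show "max_doubling_rate J k p = doubling_rate J (\<lambda>j. sqrt (p j)) k p"
    using p k J by (rule max_doubling_rate_eq)
  \<comment> \<open>Positivity of all \<open>p j\<close> makes the square roots an admissible bet,
    so the upper bound is attained and not merely approached.\<close>
  show "is_arg_max (\<lambda>\<eta>'. doubling_rate J \<eta>' k p) (betting_vector J) (\<lambda>j. sqrt (p j))"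
    if "\<forall>j\<in>{1..J}. 0 < p j"
    using betting_vector_sqrt[OF p _ J] doubling_rate_le[OF p k] that
    by (auto simp: is_arg_max_def not_less)
qed

end
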